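(* The polynomials $[y_1,y_2]$ and $z_1z_2z_3$ form a basis for the $\mathbb{Z}_2$-graded identities of the algebra $\mathcal{A}^1$; that is, the ideal $\mathrm{Id}_{\mathbb{Z}_2}(\mathcal{A}^1)$ is generated, as a $\mathbb{Z}_2$-graded T-ideal, by these two polynomials.
   Context: $K$ is a field of characteristic zero, $e_{i,j}$ are the matrix units of $M_3(K)$, and $A = K(e_{1,1}+e_{3,3})\oplus Ke_{2,2}\oplus Ke_{1,2}\oplus Ke_{2,3}\oplus Ke_{1,3}$. $\mathcal{A}^1$ denotes $A$ with the $\mathbb{Z}_2$-grading $A_0=\mathrm{Span}(e_{1,1}+e_{3,3},e_{2,2},e_{1,3})$, $A_1=\mathrm{Span}(e_{1,2},e_{2,3})$. $K\langle Y,Z\rangle$ is the free unital associative algebra on the variables $y_1,y_2,\dots$ of degree $0$ and $z_1,z_2,\dots$ of degree $1$, with the induced $\mathbb{Z}_2$-grading. A polynomial $f(y_1,\dots,y_m,z_1,\dots,z_n)$ is a $\mathbb{Z}_2$-graded identity of a $\mathbb{Z}_2$-graded algebra $B=B_0\oplus B_1$ if it vanishes whenever the $y_i$ are replaced by elements of $B_0$ and the $z_j$ by elements of $B_1$; $\mathrm{Id}_{\mathbb{Z}_2}(B)$ is the ideal of all of them. A $\mathbb{Z}_2$-graded T-ideal is an ideal of $K\langle Y,Z\rangle$ closed under all degree-preserving endomorphisms of $K\langle Y,Z\rangle$. $[a,b]=ab-ba$. *)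

theory Defs
  imports "HOL-Analysis.Analysis" "HOL-Library.Poly_Mapping"
begin

section \<open>The free algebra on even and odd variables\<close>

datatype var = Y nat | Z nat

text \<open>With concatenation as addition, lists form the free monoid, so that finitely supported
  functions \<open>var list \<Rightarrow>\<^sub>0 'k\<close> under the convolution product are the free unital
  associative algebra on the variables.\<close>

instantiation list :: (type) monoid_add
begin

definition zero_list_def: "(0 :: 'a list) = []"
definition plus_list_def: "(xs :: 'a list) + ys = xs @ ys"

instance
  by standard (simp_all add: zero_list_def plus_list_def)

end

type_synonym 'k free_alg = "var list \<Rightarrow>\<^sub>0 'k"

definition scalar :: "'k::field_char_0 \<Rightarrow> 'k free_alg" where
  "scalar c = Poly_Mapping.single [] c"

definition yv :: "nat \<Rightarrow> 'k::field_char_0 free_alg" where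
  "yv i = Poly_Mapping.single [Y i] 1"

definition zv :: "nat \<Rightarrow> 'k::field_char_0 free_alg" where
  "zv i = Poly_Mapping.single [Z i] 1"

definition commutator :: "'r::ring \<Rightarrow> 'r \<Rightarrow> 'r" where
  "commutator a b = a * b - b * a"

fun is_odd_var :: "var \<Rightarrow> bool" where
  "is_odd_var (Y i) = False"
| "is_odd_var (Z i) = True"

definition word_odd :: "var list \<Rightarrow> bool" where
  "word_odd w \<longleftrightarrow> odd (length (filter is_odd_var w))"

definition free_even :: "'k::field_char_0 free_alg set" where
  "free_even = {f. \<forall>w\<in>Poly_Mapping.keys f. \<not> word_odd w}"

definition free_odd :: "'k::field_char_0 free_alg set" where
  "free_odd = {f. \<forall>w\<in>Poly_Mapping.keys f. word_odd w}"

section \<open>Graded T-ideals\<close>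

definition two_sided_ideal :: "'r::ring_1 set \<Rightarrow> bool" where
  "two_sided_ideal I \<longleftrightarrow>
     0 \<in> I \<and> (\<forall>f\<in>I. \<forall>g\<in>I. f + g \<in> I) \<and> (\<forall>f\<in>I. \<forall>a. a * f \<in> I \<and> f * a \<in> I)"

definition alg_endo :: "('k::field_char_0 free_alg \<Rightarrow> 'k free_alg) \<Rightarrow> bool" where
  "alg_endo \<phi> \<longleftrightarrow>
     (\<forall>f g. \<phi> (f + g) = \<phi> f + \<phi> g) \<and> (\<forall>f g. \<phi> (f * g) = \<phi> f * \<phi> g) \<and>
     (\<forall>c. \<phi> (scalar c) = scalar c)"

definition graded_endo :: "('k::field_char_0 free_alg \<Rightarrow> 'k free_alg) \<Rightarrow> bool" where
  "graded_endo \<phi> \<longleftrightarrow>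
     alg_endo \<phi> \<and> \<phi> ` free_even \<subseteq> free_even \<and> \<phi> ` free_odd \<subseteq> free_odd"

definition graded_T_ideal :: "'k::field_char_0 free_alg set \<Rightarrow> bool" where
  "graded_T_ideal I \<longleftrightarrow> two_sided_ideal I \<and> (\<forall>\<phi>. graded_endo \<phi> \<longrightarrow> \<phi> ` I \<subseteq> I)"

definition graded_T_ideal_generated ::
    "'k::field_char_0 free_alg set \<Rightarrow> 'k free_alg set" where
  "graded_T_ideal_generated S = \<Inter>{I. graded_T_ideal I \<and> S \<subseteq> I}"

section \<open>Graded matrix algebras and their graded identities\<close>

definition mat_scale :: "'k::field_char_0 \<Rightarrow> 'k^'n^'n \<Rightarrow> 'k^'n^'n" where
  "mat_scale c M = (\<chi> i j. c * M $ i $ j)"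

interpretation mat: vector_space "mat_scale :: 'k::field_char_0 \<Rightarrow> 'k^'n^'n \<Rightarrow> 'k^'n^'n"
  by standard (simp_all add: mat_scale_def vec_eq_iff algebra_simps)

definition graded_matrix_algebra ::
    "('k::field_char_0^'n^'n) set \<Rightarrow> ('k^'n^'n) set \<Rightarrow> ('k^'n^'n) set \<Rightarrow> bool" where
  "graded_matrix_algebra B B0 B1 \<longleftrightarrow>
     mat.subspace B0 \<and> mat.subspace B1 \<and> B0 \<inter> B1 = {0} \<and>
     B = {a + b | a b. a \<in> B0 \<and> b \<in> B1} \<and> mat 1 \<in> B0 \<and>
     (\<forall>a\<in>B0. \<forall>b\<in>B0. a ** b \<in> B0) \<and> (\<forall>a\<in>B0. \<forall>b\<in>B1. a ** b \<in> B1) \<and>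
     (\<forall>a\<in>B1. \<forall>b\<in>B0. a ** b \<in> B1) \<and> (\<forall>a\<in>B1. \<forall>b\<in>B1. a ** b \<in> B0)"

definition eval_word :: "(var \<Rightarrow> 'k::field_char_0^'n^'n) \<Rightarrow> var list \<Rightarrow> 'k^'n^'n" where
  "eval_word \<rho> w = foldr (**) (map \<rho> w) (mat 1)"

definition eval_poly ::
    "(var \<Rightarrow> 'k::field_char_0^'n^'n) \<Rightarrow> 'k free_alg \<Rightarrow> 'k^'n^'n" where
  "eval_poly \<rho> f =
     (\<Sum>w\<in>Poly_Mapping.keys f. mat_scale (Poly_Mapping.lookup f w) (eval_word \<rho> w))"

definition graded_identities ::
    "('k::field_char_0^'n^'n) set \<Rightarrow> ('k^'n^'n) set \<Rightarrow> 'k free_alg set" where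
  "graded_identities B0 B1 =
     {f. \<forall>\<rho>. (\<forall>i. \<rho> (Y i) \<in> B0) \<and> (\<forall>j. \<rho> (Z j) \<in> B1) \<longrightarrow> eval_poly \<rho> f = 0}"

section \<open>The graded algebra in question\<close>

definition mat_unit :: "3 \<Rightarrow> 3 \<Rightarrow> 'k::field_char_0^3^3" where
  "mat_unit i j = axis i (axis j 1)"

definition alg_A :: "('k::field_char_0^3^3) set" where
  "alg_A = mat.span {mat_unit 1 1 + mat_unit 3 3, mat_unit 2 2,
                     mat_unit 1 2, mat_unit 2 3, mat_unit 1 3}"

definition alg_A0 :: "('k::field_char_0^3^3) set" where
  "alg_A0 = mat.span {mat_unit 1 1 + mat_unit 3 3, mat_unit 2 2, mat_unit 1 3}"

definition alg_A1 :: "('k::field_char_0^3^3) set" where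
  "alg_A1 = mat.span {mat_unit 1 2, mat_unit 2 3}"

lemma alg_A0_iff:
  "M \<in> alg_A0 \<longleftrightarrow> (\<exists>a b c. M = mat_scale a (mat_unit 1 1 + mat_unit 3 3) +
     mat_scale b (mat_unit 2 2) + mat_scale c (mat_unit 1 3))"
  unfolding alg_A0_def
  by (auto simp: mat.span_insert mat.span_empty diff_eq_eq) (metis add.commute add.left_commute)+

lemma alg_A1_iff:
  "M \<in> alg_A1 \<longleftrightarrow> (\<exists>a b. M = mat_scale a (mat_unit 1 2) + mat_scale b (mat_unit 2 3))"
  unfolding alg_A1_def
  by (auto simp: mat.span_insert mat.span_empty diff_eq_eq) (metis add.commute)+

lemmas alg_A_simps =
  mat_scale_def mat_unit_def axis_def vec_eq_iff forall_3 matrix_matrix_mult_def sum_3 mat_def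

lemma alg_A_graded: "graded_matrix_algebra (alg_A :: ('k::field_char_0^3^3) set) alg_A0 alg_A1"
proof -
  have "alg_A0 \<inter> alg_A1 = {0 :: 'k^3^3}"
    by (auto simp: alg_A0_iff alg_A1_iff alg_A_simps)
  moreover have "(alg_A :: ('k^3^3) set) = {a + b | a b. a \<in> alg_A0 \<and> b \<in> alg_A1}"
    unfolding alg_A_def alg_A0_def alg_A1_def mat.span_Un[symmetric]
    by (rule arg_cong[where f = mat.span]) auto
  moreover have "(mat 1 :: 'k^3^3) \<in> alg_A0"
    unfolding alg_A0_iff
    by (rule exI[of _ 1], rule exI[of _ 1], rule exI[of _ 0]) (simp add: alg_A_simps)
  moreover have "a ** b \<in> alg_A0" if "a \<in> alg_A0" "b \<in> alg_A0" for a b :: "'k^3^3"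
    using that unfolding alg_A0_iff by (auto simp: alg_A_simps)
  moreover have "a ** b \<in> alg_A1" if "a \<in> alg_A0" "b \<in> alg_A1" for a b :: "'k^3^3"
    using that unfolding alg_A0_iff alg_A1_iff by (auto simp: alg_A_simps)
  moreover have "a ** b \<in> alg_A1" if "a \<in> alg_A1" "b \<in> alg_A0" for a b :: "'k^3^3"
    using that unfolding alg_A0_iff alg_A1_iff by (auto simp: alg_A_simps)
  moreover have "a ** b \<in> alg_A0" if "a \<in> alg_A1" "b \<in> alg_A1" for a b :: "'k^3^3"
    using that unfolding alg_A0_iff alg_A1_iff by (auto simp: alg_A_simps)
  ultimately show ?thesis
    unfolding graded_matrix_algebra_def by (auto simp: alg_A0_def alg_A1_def)
qed

end

theory Submission
  imports Defs "HOL-Computational_Algebra.Primes" "HOL-Computational_Algebra.Polynomial"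
begin

text \<open>
  Both generators are identities: even elements of the algebra commute, and a product of three
  odd elements is zero. Substituting along an endomorphism of the free algebra and then
  evaluating is again an evaluation, so the identities form a graded T-ideal, which therefore
  contains the one generated by the two polynomials.

  For the converse, work modulo a graded T-ideal \<open>I\<close> that contains the generators. Arbitrary even
  elements may be substituted into the first generator, so even words commute; arbitrary odd
  elements may be substituted into the second, so a word with three or more odd letters
  lies in \<open>I\<close>. A word with at most two odd letters has one of the forms \<open>u\<close>, \<open>u z v\<close> and
  \<open>u z v z' r\<close>, with \<open>u\<close>, \<open>v\<close>, \<open>r\<close> products of even letters. Each of these products may be
  reordered, and in the last case \<open>z v z'\<close> is even, so that \<open>r\<close> can be moved past it to \<open>u\<close>. What
  remains of the word is its trace: the multiset of its even letters outside the two odd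
  letters, the multiset of those inside, and the two odd letters in their order. Words with
  equal traces are congruent (\<open>cong_canon\<close>).

  It remains to see that a graded identity cannot relate different traces. Substitute diagonal
  matrices \<open>a\<^sub>i (e\<^sub>1\<^sub>1 + e\<^sub>3\<^sub>3) + b\<^sub>i e\<^sub>2\<^sub>2\<close> for the even variables and \<open>p\<^sub>j e\<^sub>1\<^sub>2 + q\<^sub>j e\<^sub>2\<^sub>3\<close>
  for the odd ones. Reading a word from the left, starting at row 1, an odd letter steps to the
  next row, so the first row of the value has at most one nonzero entry, the product over the
  trace of the scalars attached to its elements (\<open>row_sum_probe\<close>). With \<open>t\<close>-th powers of
  distinct primes for the scalars, this entry is \<open>n ^ t\<close> with \<open>n\<close> determined by the trace and
  determining it, by unique factorization. Since distinct numbers have linearly independent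
  sequences of powers (\<open>power_sums_independent\<close>), the coefficients of an identity sum to zero
  over the words of each trace (\<open>trace_sums_vanish\<close>). Hence the identity is congruent to zero
  (\<open>identity_in_I\<close>).
\<close>

section \<open>Linear maps on the free algebra\<close>

abbreviation monomial :: "var list \<Rightarrow> 'k::field_char_0 \<Rightarrow> 'k free_alg" where
  "monomial \<equiv> Poly_Mapping.single"

lemma sum_monomials: "f = (\<Sum>w\<in>Poly_Mapping.keys f. monomial w (Poly_Mapping.lookup f w))"
  by (rule poly_mapping_eqI)
    (simp add: lookup_sum lookup_single when_def sum.delta in_keys_iff)

text \<open>The monomials, taken with all their coefficients, generate the additive group of the free
  algebra, so additivity does the work of linearity.\<close>

lemma additive_eqI:
  fixes F G :: "'k::field_char_0 free_alg \<Rightarrow> 'b::ab_group_add"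
  assumes F: "\<And>f g. F (f + g) = F f + F g" and G: "\<And>f g. G (f + g) = G f + G g"
    and eq: "\<And>w c. F (monomial w c) = G (monomial w c)"
  shows "F f = G f"
proof -
  have zero: "F 0 = 0" "G 0 = 0"
    using F[of 0 0] G[of 0 0] by simp_all
  have "F (\<Sum>w\<in>S. monomial w (c w)) = G (\<Sum>w\<in>S. monomial w (c w))" if "finite S" for S c
    using that by induction (simp_all add: zero F G eq)
  then show ?thesis
    using sum_monomials[of f] by (metis finite_keys)
qed

text \<open>The coefficient is an argument of \<open>h\<close>, rather than a factor of a fixed scalar multiplication,
  so that the same construction serves maps into the free algebra and into matrices, whose
  scalar multiplications differ.\<close>

definition lin_ext :: "(var list \<Rightarrow> 'k \<Rightarrow> 'b) \<Rightarrow> 'k::field_char_0 free_alg \<Rightarrow> 'b::ab_group_add" where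
  "lin_ext h f = (\<Sum>w\<in>Poly_Mapping.keys f. h w (Poly_Mapping.lookup f w))"

context
  fixes h :: "var list \<Rightarrow> 'k::field_char_0 \<Rightarrow> 'b::ab_group_add"
  assumes h_add: "\<And>w a b. h w (a + b) = h w a + h w b"
begin

lemma h_0: "h w 0 = 0"
  using h_add[of w 0 0] by simp

lemma lin_ext_superset:
  assumes "finite S" "Poly_Mapping.keys f \<subseteq> S"
  shows "lin_ext h f = (\<Sum>w\<in>S. h w (Poly_Mapping.lookup f w))"
  unfolding lin_ext_def using assms
  by (intro sum.mono_neutral_left) (auto simp: in_keys_iff h_0)

lemma lin_ext_add: "lin_ext h (f + g) = lin_ext h f + lin_ext h g"
proof -
  let ?S = "Poly_Mapping.keys f \<union> Poly_Mapping.keys g"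
  have "lin_ext h p = (\<Sum>w\<in>?S. h w (Poly_Mapping.lookup p w))" if "p \<in> {f, g, f + g}" for p
    using that keys_add[of f g] by (intro lin_ext_superset) auto
  then show ?thesis
    by (simp add: lookup_add h_add sum.distrib)
qed

lemma lin_ext_monomial: "lin_ext h (monomial w c) = h w c"
  by (simp add: lin_ext_def h_0)

text \<open>The product \<open>m\<close> is a parameter because the matrix product \<open>(**)\<close> is not the class operation
  \<open>(*)\<close> of the matrix type, which is componentwise.\<close>

lemma lin_ext_mult:
  assumes m_left: "\<And>a b c. m (a + b) c = m a c + m b c"
    and m_right: "\<And>a b c. m c (a + b) = m c a + m c b"
    and h_mult: "\<And>v w a b. h (v @ w) (a * b) = m (h v a) (h w b)"
  shows "lin_ext h (f * g) = m (lin_ext h f) (lin_ext h g)"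
proof (rule additive_eqI[of "\<lambda>f. lin_ext h (f * g)" "\<lambda>f. m (lin_ext h f) (lin_ext h g)"])
  fix w and c :: 'k
  show "lin_ext h (monomial w c * g) = m (lin_ext h (monomial w c)) (lin_ext h g)"
    by (rule additive_eqI[of "\<lambda>g. lin_ext h (monomial w c * g)"
          "\<lambda>g. m (lin_ext h (monomial w c)) (lin_ext h g)"])
      (simp_all add: distrib_left lin_ext_add lin_ext_monomial m_right mult_single
        plus_list_def h_mult)
qed (simp_all add: distrib_right lin_ext_add m_left)

end

section \<open>Parity and substitutions\<close>

text \<open>A common name for the two homogeneous components, which lets products be treated by adding
  parities instead of by four cases.\<close>

definition free_part :: "bool \<Rightarrow> 'k::field_char_0 free_alg set" where
  "free_part p = {f. \<forall>w\<in>Poly_Mapping.keys f. word_odd w = p}"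

lemma free_part_simps: "free_part False = free_even" "free_part True = free_odd"
  by (auto simp: free_part_def free_even_def free_odd_def)

lemma word_odd_simps [simp]:
  "\<not> word_odd []" "word_odd (v @ w) = (word_odd v \<noteq> word_odd w)"
  "word_odd (Y i # w) = word_odd w" "word_odd (Z i # w) = (\<not> word_odd w)"
  by (auto simp: word_odd_def)

lemma free_part_monomial: "word_odd w = p \<Longrightarrow> monomial w c \<in> free_part p"
  by (simp add: free_part_def)

lemma free_part_0: "0 \<in> free_part p"
  by (simp add: free_part_def)

lemma free_part_add: "f \<in> free_part p \<Longrightarrow> g \<in> free_part p \<Longrightarrow> f + g \<in> free_part p"
  using keys_add[of f g] by (auto simp: free_part_def)

lemma free_part_mult: "f \<in> free_part p \<Longrightarrow> g \<in> free_part q \<Longrightarrow> f * g \<in> free_part (p \<noteq> q)"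
  using keys_mult[of f g] by (fastforce simp: free_part_def plus_list_def)

lemma free_part_sum: "(\<And>x. x \<in> S \<Longrightarrow> f x \<in> free_part p) \<Longrightarrow> sum f S \<in> free_part p"
  by (induction S rule: infinite_finite_induct) (auto intro: free_part_0 free_part_add)

text \<open>The endomorphism that sends each variable \<open>x\<close> to \<open>\<sigma> x\<close>. The defining closure property of a
  graded T-ideal is used through maps of this form.\<close>

definition subst :: "(var \<Rightarrow> 'k::field_char_0 free_alg) \<Rightarrow> 'k free_alg \<Rightarrow> 'k free_alg" where
  "subst \<sigma> = lin_ext (\<lambda>w c. scalar c * prod_list (map \<sigma> w))"

lemma scalar_add: "scalar (a + b) = scalar a + scalar b"
  by (simp add: scalar_def single_add)

lemma scalar_mult: "scalar (a * b) = scalar a * scalar b"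
  by (simp add: scalar_def mult_single plus_list_def)

lemma scalar_commute: "scalar c * f = f * scalar c"
  by (rule additive_eqI)
    (simp_all add: distrib_left distrib_right scalar_def mult_single plus_list_def mult.commute)

lemma scalar_1: "scalar 1 = 1"
  by (metis scalar_def single_one zero_list_def)

lemma subst_add: "subst \<sigma> (f + g) = subst \<sigma> f + subst \<sigma> g"
  unfolding subst_def by (rule lin_ext_add) (simp add: scalar_add distrib_right)

lemma subst_monomial: "subst \<sigma> (monomial w c) = scalar c * prod_list (map \<sigma> w)"
  unfolding subst_def by (rule lin_ext_monomial) (simp add: scalar_add distrib_right)

lemma subst_mult: "subst \<sigma> (f * g) = subst \<sigma> f * subst \<sigma> g"
  unfolding subst_def
proof (rule lin_ext_mult)
  fix v w and a b :: 'a
  have "scalar a * prod_list (map \<sigma> v) * (scalar b * prod_list (map \<sigma> w)) =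
      scalar a * (prod_list (map \<sigma> v) * scalar b) * prod_list (map \<sigma> w)"
    by (simp only: mult.assoc)
  also have "\<dots> = scalar (a * b) * prod_list (map \<sigma> (v @ w))"
    by (simp only: scalar_commute[symmetric])
      (simp only: scalar_mult mult.assoc map_append prod_list.append)
  finally show "scalar (a * b) * prod_list (map \<sigma> (v @ w)) =
      scalar a * prod_list (map \<sigma> v) * (scalar b * prod_list (map \<sigma> w))" ..
qed (simp_all add: scalar_add distrib_right distrib_left)

lemma prod_list_parity:
  assumes "\<And>x. \<sigma> x \<in> free_part (is_odd_var x)"
  shows "prod_list (map \<sigma> w) \<in> free_part (word_odd w)"
proof (induction w)
  case Nil
  show ?case
    using free_part_monomial[of "[]" False 1] by (simp flip: scalar_1 add: scalar_def)
next
  case (Cons x w)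
  show ?case
    using free_part_mult[OF assms[of x] Cons.IH] by (cases x) simp_all
qed

lemma graded_endo_subst:
  assumes "\<And>x. \<sigma> x \<in> free_part (is_odd_var x)"
  shows "graded_endo (subst \<sigma>)"
proof -
  have "subst \<sigma> f \<in> free_part p" if "f \<in> free_part p" for f p
    unfolding subst_def lin_ext_def
  proof (rule free_part_sum)
    fix w assume "w \<in> Poly_Mapping.keys f"
    then have "word_odd w = p"
      using that by (auto simp: free_part_def)
    then show "scalar (Poly_Mapping.lookup f w) * prod_list (map \<sigma> w) \<in> free_part p"
      using free_part_mult[OF free_part_monomial[of "[]" False] prod_list_parity[OF assms, of w]]
      by (simp add: scalar_def)
  qed
  then have "subst \<sigma> ` free_part p \<subseteq> free_part p" for p
    by auto
  from this[of False] this[of True] show ?thesis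
    unfolding graded_endo_def alg_endo_def
    by (simp add: subst_add subst_mult free_part_simps)
      (simp add: scalar_def subst_monomial)
qed

section \<open>The identities form a graded T-ideal\<close>

lemma mat_scale_mult: "mat_scale a M ** mat_scale b N = mat_scale (a * b) (M ** N)"
  by (simp add: mat_scale_def matrix_matrix_mult_def vec_eq_iff sum_distrib_left mult.assoc
      mult.left_commute)

lemma eval_word_Nil: "eval_word \<rho> [] = mat 1"
  by (simp add: eval_word_def)

lemma eval_word_Cons: "eval_word \<rho> (x # w) = \<rho> x ** eval_word \<rho> w"
  by (simp add: eval_word_def)

lemma eval_word_append: "eval_word \<rho> (v @ w) = eval_word \<rho> v ** eval_word \<rho> w"
  by (induction v) (simp_all add: eval_word_Nil eval_word_Cons matrix_mul_assoc)

lemma eval_poly_lin_ext: "eval_poly \<rho> = lin_ext (\<lambda>w c. mat_scale c (eval_word \<rho> w))"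
  by (simp add: fun_eq_iff eval_poly_def lin_ext_def)

lemma eval_poly_add: "eval_poly \<rho> (f + g) = eval_poly \<rho> f + eval_poly \<rho> g"
  unfolding eval_poly_lin_ext by (rule lin_ext_add) (rule mat.scale_left_distrib)

lemma eval_poly_monomial: "eval_poly \<rho> (monomial w c) = mat_scale c (eval_word \<rho> w)"
  unfolding eval_poly_lin_ext by (rule lin_ext_monomial) (rule mat.scale_left_distrib)

lemma matrix_add_right: "(A + B) ** C = A ** C + B ** (C :: 'a::semiring_1^'n^'n)"
  by (simp add: matrix_matrix_mult_def vec_eq_iff distrib_right sum.distrib)

lemma eval_poly_mult: "eval_poly \<rho> (f * g) = eval_poly \<rho> f ** eval_poly \<rho> g"
  unfolding eval_poly_lin_ext
  by (rule lin_ext_mult)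
    (simp_all add: mat.scale_left_distrib matrix_add_ldistrib matrix_add_right mat_scale_mult
      eval_word_append)

lemma eval_poly_0: "eval_poly \<rho> 0 = 0"
  by (simp add: eval_poly_def)

lemma eval_poly_minus: "eval_poly \<rho> (f - g) = eval_poly \<rho> f - eval_poly \<rho> g"
  using eval_poly_add[of \<rho> "f - g" g] by simp

text \<open>An evaluation is determined by the values of the variables, and evaluating after an
  endomorphism is multiplicative and linear. The composite is thus the evaluation at the
  values of the images of the variables.\<close>

lemma eval_poly_endo:
  assumes "alg_endo \<phi>"
  shows "eval_poly \<rho> (\<phi> f) = eval_poly (\<lambda>x. eval_poly \<rho> (\<phi> (monomial [x] 1))) f"
proof (rule additive_eqI[of "\<lambda>f. eval_poly \<rho> (\<phi> f)"])
  fix w and c :: 'a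
  let ?\<rho> = "\<lambda>x. eval_poly \<rho> (\<phi> (monomial [x] 1))"
  have word: "eval_poly \<rho> (\<phi> (monomial w 1)) = eval_word ?\<rho> w"
  proof (induction w)
    case Nil
    have "\<phi> (monomial [] 1) = monomial [] 1"
      using assms by (simp add: alg_endo_def flip: scalar_def)
    then show ?case
      by (simp add: eval_poly_monomial eval_word_Nil)
  next
    case (Cons x w)
    have "monomial (x # w) (1::'a) = monomial [x] 1 * monomial w 1"
      by (simp add: mult_single plus_list_def)
    with assms have "\<phi> (monomial (x # w) 1) = \<phi> (monomial [x] 1) * \<phi> (monomial w 1)"
      by (simp add: alg_endo_def)
    then show ?case
      by (simp add: eval_poly_mult eval_word_Cons Cons.IH)
  qed
  have "monomial w c = scalar c * monomial w 1"
    by (simp add: scalar_def mult_single plus_list_def)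
  then have "\<phi> (monomial w c) = scalar c * \<phi> (monomial w 1)"
    using assms by (simp add: alg_endo_def)
  then have "eval_poly \<rho> (\<phi> (monomial w c)) = mat_scale c (mat 1) ** mat_scale 1 (eval_word ?\<rho> w)"
    by (simp add: eval_poly_mult word) (simp add: scalar_def eval_poly_monomial eval_word_Nil)
  then show "eval_poly \<rho> (\<phi> (monomial w c)) = eval_poly ?\<rho> (monomial w c)"
    by (simp only: mat_scale_mult eval_poly_monomial) simp
qed (use assms in \<open>simp_all add: alg_endo_def eval_poly_add\<close>)

text \<open>A graded endomorphism turns an admissible substitution into an admissible one, because
  evaluation maps each homogeneous component of the free algebra into the component of the
  same degree.\<close>

lemma graded_T_ideal_graded_identities:
  fixes B0 B1 :: "('k::field_char_0^'n^'n) set"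
  assumes "graded_matrix_algebra B B0 B1"
  shows "graded_T_ideal (graded_identities B0 B1)"
proof -
  let ?part = "\<lambda>p. if p then B1 else B0"
  have sub: "mat.subspace (?part p)" for p
    using assms by (simp add: graded_matrix_algebra_def)
  have word: "eval_word \<rho> w \<in> ?part (word_odd w)"
    if "\<And>x. \<rho> x \<in> ?part (is_odd_var x)" for \<rho> w
  proof (induction w)
    case Nil
    show ?case
      using assms by (simp add: eval_word_Nil graded_matrix_algebra_def)
  next
    case (Cons x w)
    then show ?case
      using that[of x] assms
      by (cases x) (auto simp: eval_word_Cons graded_matrix_algebra_def split: if_splits)
  qed
  have eval: "eval_poly \<rho> f \<in> ?part p"
    if "\<And>x. \<rho> x \<in> ?part (is_odd_var x)" "f \<in> free_part p" for \<rho> f p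
    unfolding eval_poly_def
  proof (rule mat.subspace_sum[OF sub])
    fix w assume "w \<in> Poly_Mapping.keys f"
    then have "word_odd w = p"
      using that(2) by (auto simp: free_part_def)
    then show "mat_scale (Poly_Mapping.lookup f w) (eval_word \<rho> w) \<in> ?part p"
      using word[OF that(1), of w] mat.subspace_scale[OF sub, of _ p] by blast
  qed
  have adm: "(\<forall>i. \<rho> (Y i) \<in> B0) \<and> (\<forall>j. \<rho> (Z j) \<in> B1) \<longleftrightarrow> (\<forall>x. \<rho> x \<in> ?part (is_odd_var x))"
    for \<rho> :: "var \<Rightarrow> 'k^'n^'n"
  proof
    assume "(\<forall>i. \<rho> (Y i) \<in> B0) \<and> (\<forall>j. \<rho> (Z j) \<in> B1)"
    then show "\<forall>x. \<rho> x \<in> ?part (is_odd_var x)"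
      by (intro allI, case_tac x) simp_all
  next
    assume a: "\<forall>x. \<rho> x \<in> ?part (is_odd_var x)"
    show "(\<forall>i. \<rho> (Y i) \<in> B0) \<and> (\<forall>j. \<rho> (Z j) \<in> B1)"
      using a[rule_format, of "Y i" for i] a[rule_format, of "Z i" for i] by simp
  qed
  have "\<phi> f \<in> graded_identities B0 B1"
    if \<phi>: "graded_endo \<phi>" and f: "f \<in> graded_identities B0 B1" for \<phi> f
    unfolding graded_identities_def adm mem_Collect_eq
  proof (intro allI impI)
    fix \<rho> :: "var \<Rightarrow> 'k^'n^'n" assume \<rho>: "\<forall>x. \<rho> x \<in> ?part (is_odd_var x)"
    have "\<phi> ` free_part p \<subseteq> free_part p" for p
      using \<phi> by (cases p) (simp_all add: graded_endo_def free_part_simps)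
    moreover have "monomial [x] 1 \<in> free_part (is_odd_var x)" for x
      by (rule free_part_monomial) (simp add: word_odd_def)
    ultimately have "\<phi> (monomial [x] 1) \<in> free_part (is_odd_var x)" for x
      by (meson image_subset_iff)
    then have "\<forall>x. eval_poly \<rho> (\<phi> (monomial [x] 1)) \<in> ?part (is_odd_var x)"
      using \<rho> by (intro allI eval) simp_all
    then have "eval_poly (\<lambda>x. eval_poly \<rho> (\<phi> (monomial [x] 1))) f = 0"
      by (rule f[unfolded graded_identities_def adm mem_Collect_eq, THEN spec, THEN mp])
    then show "eval_poly \<rho> (\<phi> f) = 0"
      using \<phi> by (subst eval_poly_endo) (simp_all add: graded_endo_def)
  qed
  moreover have "two_sided_ideal (graded_identities B0 B1)"
    by (simp add: two_sided_ideal_def graded_identities_def eval_poly_0 eval_poly_add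
        eval_poly_mult)
  ultimately show ?thesis
    by (auto simp: graded_T_ideal_def)
qed

lemma generators_identities:
  "commutator (yv 1) (yv 2) \<in> graded_identities (alg_A0 :: ('k::field_char_0^3^3) set) alg_A1"
  "zv 1 * zv 2 * zv 3 \<in> graded_identities (alg_A0 :: ('k::field_char_0^3^3) set) alg_A1"
proof -
  have even: "M ** N = N ** M" if "M \<in> alg_A0" "N \<in> alg_A0" for M N :: "'k^3^3"
    using that unfolding alg_A0_iff by (auto simp: alg_A_simps)
  have odd: "L ** M ** N = 0" if "L \<in> alg_A1" "M \<in> alg_A1" "N \<in> alg_A1" for L M N :: "'k^3^3"
    using that unfolding alg_A1_iff by (auto simp: alg_A_simps)
  have v: "eval_poly \<rho> (monomial [x] 1) = \<rho> x" for \<rho> :: "var \<Rightarrow> 'k^3^3" and x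
    by (simp add: eval_poly_monomial eval_word_Cons eval_word_Nil)
  show "commutator (yv 1) (yv 2) \<in> graded_identities (alg_A0 :: ('k^3^3) set) alg_A1"
    by (auto simp: graded_identities_def commutator_def yv_def eval_poly_minus eval_poly_mult v
        intro: even)
  show "zv 1 * zv 2 * zv 3 \<in> graded_identities (alg_A0 :: ('k^3^3) set) alg_A1"
    by (auto simp: graded_identities_def zv_def eval_poly_mult v intro: odd)
qed

section \<open>Words modulo the generated T-ideal\<close>

text \<open>The trace of a word records all that survives modulo the relations: for an even letter, whether
  it stands between the two odd letters (\<open>Inner\<close>) or not (\<open>Outer\<close>); for an odd letter,
  whether it is the first or the second one. The argument \<open>k\<close> of \<open>trace\<close> is the number of
  odd letters already passed. Even letters before the first and after the second odd letter
  get the same kind. For a word with more than two odd letters the trace has no meaning.\<close>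

datatype kind = Outer | Inner | First | Second

fun trace :: "nat \<Rightarrow> var list \<Rightarrow> (kind \<times> nat) multiset" where
  "trace k [] = {#}"
| "trace k (Y i # w) = add_mset (if k = 1 then Inner else Outer, i) (trace k w)"
| "trace k (Z j # w) = add_mset (if k = 0 then First else Second, j) (trace (Suc k) w)"

definition num_z :: "var list \<Rightarrow> nat" where
  "num_z w = length (filter is_odd_var w)"

lemma num_z_simps [simp]:
  "num_z [] = 0" "num_z (Y i # w) = num_z w" "num_z (Z i # w) = Suc (num_z w)"
  "num_z (v @ w) = num_z v + num_z w"
  by (simp_all add: num_z_def)

lemma num_z_0_E:
  assumes "num_z w = 0"
  obtains us where "w = map Y us"
proof -
  have "\<exists>us. w = map Y us"
    using assms
  proof (induction w)
    case (Cons x w)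
    then obtain i us where "x = Y i" "w = map Y us"
      by (cases x) auto
    then have "x # w = map Y (i # us)"
      by simp
    then show ?case ..
  qed simp
  with that show ?thesis by blast
qed

lemma first_z_E:
  assumes "num_z w = Suc n"
  obtains us j v where "w = map Y us @ Z j # v" "num_z v = n"
proof -
  have "\<exists>us j v. w = map Y us @ Z j # v \<and> num_z v = n"
    using assms
  proof (induction w)
    case (Cons x w)
    show ?case
    proof (cases x)
      case (Y i)
      then obtain us j v where "w = map Y us @ Z j # v" "num_z v = n"
        using Cons by auto
      then have "x # w = map Y (i # us) @ Z j # v \<and> num_z v = n"
        using Y by simp
      then show ?thesis by blast
    next
      case (Z j)
      then have "x # w = map Y [] @ Z j # w \<and> num_z w = n"
        using Cons by simp
      then show ?thesis by blast
    qed
  qed simp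
  with that show ?thesis by blast
qed

lemma trace_append_even:
  "trace k (map Y us @ w) = image_mset (Pair (if k = 1 then Inner else Outer)) (mset us) + trace k w"
  by (induction us) auto

definition indices :: "kind \<Rightarrow> (kind \<times> nat) multiset \<Rightarrow> nat list" where
  "indices c L = sorted_list_of_multiset (image_mset snd (filter_mset (\<lambda>l. fst l = c) L))"

text \<open>A representative of the words with a given trace: it depends on the trace alone because
  the indices of each kind are listed in sorted order.\<close>

definition canon :: "(kind \<times> nat) multiset \<Rightarrow> var list" where
  "canon L = map Y (indices Outer L) @ map Z (indices First L) @
     map Y (indices Inner L) @ map Z (indices Second L)"

lemma filter_image_Pair:
  "filter_mset (\<lambda>l. fst l = c) (image_mset (Pair d) M) = (if d = c then image_mset (Pair d) M else {#})"
  by (induction M) auto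

locale relations =
  fixes I :: "'k::field_char_0 free_alg set"
  assumes T_ideal: "graded_T_ideal I"
    and comm_gen: "commutator (yv 1) (yv 2) \<in> I"
    and zzz_gen: "zv 1 * zv 2 * zv 3 \<in> I"
begin

lemma I_0: "0 \<in> I" and I_add: "f \<in> I \<Longrightarrow> g \<in> I \<Longrightarrow> f + g \<in> I"
  and I_mult_left: "f \<in> I \<Longrightarrow> a * f \<in> I" and I_mult_right: "f \<in> I \<Longrightarrow> f * a \<in> I"
  using T_ideal by (auto simp: graded_T_ideal_def two_sided_ideal_def)

lemma I_sum: "(\<And>x. x \<in> S \<Longrightarrow> f x \<in> I) \<Longrightarrow> sum f S \<in> I"
  by (induction S rule: infinite_finite_induct) (auto intro: I_0 I_add)

lemma I_subst:
  assumes "\<And>x. \<sigma> x \<in> free_part (is_odd_var x)" "f \<in> I"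
  shows "subst \<sigma> f \<in> I"
  using T_ideal graded_endo_subst[OF assms(1)] assms(2) by (auto simp: graded_T_ideal_def)

text \<open>The first generator is a relation between two even variables only, but the endomorphism
  sending these to \<open>f\<close> and \<open>g\<close> transports it. The other variables go to \<open>0\<close>, which has
  either parity.\<close>

lemma commutator_in_I:
  assumes "f \<in> free_part False" "g \<in> free_part False"
  shows "f * g - g * f \<in> I"
proof -
  define \<sigma> where "\<sigma> x = (if x = Y 1 then f else if x = Y 2 then g else 0)" for x
  have "subst \<sigma> (commutator (yv 1) (yv 2)) \<in> I"
    by (rule I_subst[OF _ comm_gen]) (use assms in \<open>auto simp: \<sigma>_def free_part_0\<close>)
  moreover have "subst \<sigma> (commutator (yv 1) (yv 2)) + subst \<sigma> (yv 2 * yv 1) = subst \<sigma> (yv 1 * yv 2)"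
    by (simp add: commutator_def flip: subst_add)
  ultimately show ?thesis
    by (simp add: subst_mult yv_def subst_monomial scalar_1 \<sigma>_def flip: eq_diff_eq)
qed

lemma odd_product_in_I:
  assumes "f \<in> free_part True" "g \<in> free_part True" "h \<in> free_part True"
  shows "f * g * h \<in> I"
proof -
  define \<sigma> where "\<sigma> x = (if x = Z 1 then f else if x = Z 2 then g else if x = Z 3 then h else 0)" for x
  have "subst \<sigma> (zv 1 * zv 2 * zv 3) \<in> I"
    by (rule I_subst[OF _ zzz_gen]) (use assms in \<open>auto simp: \<sigma>_def free_part_0\<close>)
  then show ?thesis
    by (simp add: subst_mult zv_def subst_monomial scalar_1 \<sigma>_def)
qed

definition cong_I :: "var list \<Rightarrow> var list \<Rightarrow> bool" where
  "cong_I v w \<longleftrightarrow> monomial v 1 - monomial w 1 \<in> I"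

lemma cong_refl: "cong_I w w"
  by (simp add: cong_I_def I_0)

lemma cong_trans [trans]: "cong_I u v \<Longrightarrow> cong_I v w \<Longrightarrow> cong_I u w"
  using I_add[of "monomial u 1 - monomial v 1" "monomial v 1 - monomial w 1"]
  by (simp add: cong_I_def)

lemma cong_append:
  assumes "cong_I v v'" "cong_I w w'"
  shows "cong_I (v @ w) (v' @ w')"
proof -
  have "(monomial v 1 - monomial v' 1) * monomial w 1 +
      monomial v' 1 * (monomial w 1 - monomial w' 1) \<in> I"
    using assms by (intro I_add I_mult_left I_mult_right) (simp_all add: cong_I_def)
  then show ?thesis
    by (simp add: cong_I_def left_diff_distrib right_diff_distrib mult_single plus_list_def)
qed

lemma cong_commute:
  assumes "\<not> word_odd v" "\<not> word_odd w"
  shows "cong_I (v @ w) (w @ v)"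
  using commutator_in_I[of "monomial v 1" "monomial w 1"] assms
  by (simp add: cong_I_def free_part_monomial mult_single plus_list_def)

lemma even_word_map_Y: "\<not> word_odd (map Y us)"
  by (induction us) auto

text \<open>Even letters commute pairwise, so the first letter of the one word can be brought to the front
  of the other.\<close>

lemma cong_permute: "mset us = mset vs \<Longrightarrow> cong_I (map Y us) (map Y vs)"
proof (induction us arbitrary: vs)
  case (Cons i us)
  then obtain as bs where vs: "vs = as @ i # bs"
    by (metis list.set_intros(1) mset_eq_setD split_list)
  with Cons.prems have "mset us = mset (as @ bs)"
    by simp
  then have "cong_I ([Y i] @ map Y us) ([Y i] @ map Y (as @ bs))"
    by (intro cong_append cong_refl Cons.IH)
  also have "cong_I ([Y i] @ map Y (as @ bs)) (map Y vs)"
    using cong_append[OF cong_commute[of "[Y i]" "map Y as"] cong_refl[of "map Y bs"]]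
    by (simp add: vs even_word_map_Y)
  finally show ?case
    by simp
qed (simp add: cong_refl)

lemma cong_sorted: "cong_I (map Y us) (map Y (sort us))"
  by (rule cong_permute) simp

text \<open>The only interesting case is that of two odd letters, \<open>u z v z' r\<close>: there \<open>z v z'\<close> is an even
  word and commutes with \<open>r\<close>, which explains why \<open>u\<close> and \<open>r\<close> share the kind \<open>Outer\<close>.\<close>

lemma cong_canon:
  assumes "num_z w \<le> 2"
  shows "cong_I w (canon (trace 0 w))"
proof -
  consider "num_z w = 0" | "num_z w = Suc 0" | "num_z w = Suc (Suc 0)"
    using assms by linarith
  then show ?thesis
  proof cases
    case 1
    then obtain us where w: "w = map Y us"
      by (rule num_z_0_E)
    have "canon (trace 0 w) = map Y (sort us)"
      using trace_append_even[of 0 us "[]"]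
      by (simp add: w canon_def indices_def filter_image_Pair multiset.map_comp o_def)
    then show ?thesis
      using cong_sorted[of us] by (simp add: w)
  next
    case 2
    then obtain us j v where w: "w = map Y us @ Z j # v" and "num_z v = 0"
      by (rule first_z_E)
    then obtain vs where v: "v = map Y vs"
      by (blast elim: num_z_0_E)
    have "canon (trace 0 w) = map Y (sort us) @ [Z j] @ map Y (sort vs)"
      using trace_append_even[of 1 vs "[]"]
      by (simp add: w v trace_append_even canon_def indices_def filter_image_Pair
          multiset.map_comp o_def)
    then show ?thesis
      using cong_append[OF cong_sorted[of us] cong_append[OF cong_refl[of "[Z j]"] cong_sorted[of vs]]]
      by (simp add: w v)
  next
    case 3
    then obtain us j v where w: "w = map Y us @ Z j # v" and "num_z v = Suc 0"
      by (rule first_z_E)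
    then obtain vs k r where v: "v = map Y vs @ Z k # r" and "num_z r = 0"
      by (blast elim: first_z_E)
    then obtain rs where r: "r = map Y rs"
      by (blast elim: num_z_0_E)
    have canon: "canon (trace 0 w) = map Y (sort (us @ rs)) @ [Z j] @ map Y (sort vs) @ [Z k]"
      using trace_append_even[of 2 rs "[]"]
      by (simp add: w v r trace_append_even canon_def indices_def filter_image_Pair
          multiset.map_comp o_def numeral_2_eq_2 flip: mset_append)
    have "cong_I w (map Y us @ map Y rs @ [Z j] @ map Y vs @ [Z k])"
      using cong_append[OF cong_refl[of "map Y us"]
          cong_commute[of "[Z j] @ map Y vs @ [Z k]" "map Y rs"]]
      by (simp add: w v r even_word_map_Y)
    also have "cong_I \<dots> (canon (trace 0 w))"
      using cong_append[OF cong_sorted[of "us @ rs"] cong_append[OF cong_refl[of "[Z j]"]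
          cong_append[OF cong_sorted[of vs] cong_refl[of "[Z k]"]]]]
      by (simp add: canon)
    finally show ?thesis .
  qed
qed

text \<open>Cutting the word after each of its first three odd letters leaves three odd factors, so the
  second generator applies although the odd letters need not be adjacent.\<close>

lemma many_z_in_I:
  assumes "num_z w > 2"
  shows "monomial w 1 \<in> I"
proof -
  have "num_z w = Suc (Suc (Suc (num_z w - 3)))"
    using assms by simp
  then obtain us j v where w: "w = map Y us @ Z j # v" and "num_z v = Suc (Suc (num_z w - 3))"
    by (rule first_z_E)
  then obtain vs k r where v: "v = map Y vs @ Z k # r" and "num_z r = Suc (num_z w - 3)"
    by (blast elim: first_z_E)
  then obtain rs l t where r: "r = map Y rs @ Z l # t"
    by (blast elim: first_z_E)
  let ?a = "map Y us @ [Z j]" and ?b = "map Y vs @ [Z k]" and ?c = "map Y rs @ [Z l]"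
  have "monomial ?a 1 * monomial ?b 1 * monomial ?c 1 * monomial t 1 \<in> I"
    by (intro I_mult_right odd_product_in_I free_part_monomial) (simp_all add: even_word_map_Y)
  then show ?thesis
    by (simp add: w v r mult_single plus_list_def)
qed

end

section \<open>Separating the traces by matrix substitutions\<close>

text \<open>By linearity the hypothesis extends from powers to all polynomials; a polynomial that vanishes
  at all the points \<open>v y\<close> but \<open>v x\<close> then isolates \<open>c x\<close>.\<close>

lemma power_sums_independent:
  fixes c v :: "'a \<Rightarrow> 'k::field"
  assumes fin: "finite S" and inj: "inj_on v S"
    and eq: "\<And>t. (\<Sum>x\<in>S. c x * v x ^ t) = 0" and x: "x \<in> S"
  shows "c x = 0"
proof -
  have poly: "(\<Sum>x\<in>S. c x * poly p (v x)) = 0" for p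
  proof -
    have "(\<Sum>x\<in>S. c x * poly p (v x)) = (\<Sum>i\<le>degree p. coeff p i * (\<Sum>x\<in>S. c x * v x ^ i))"
      unfolding poly_altdef sum_distrib_left by (subst sum.swap) (simp add: mult_ac)
    then show ?thesis
      by (simp add: eq)
  qed
  define p where "p = (\<Prod>y\<in>S - {x}. [:- v y, 1:])"
  have "poly p (v y) = 0" if "y \<in> S - {x}" for y
    using that fin by (auto simp: p_def poly_prod)
  then have "(\<Sum>y\<in>S. c y * poly p (v y)) = c x * poly p (v x)"
    using fin x by (simp add: sum.remove)
  moreover have "poly p (v x) \<noteq> 0"
    using fin inj x by (auto simp: p_def poly_prod inj_on_def)
  ultimately show ?thesis
    using poly[of p] by simp
qed

instance kind :: countable
  by countable_datatype

text \<open>Distinct primes for the possible elements of a trace make the weight of a trace, the product of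
  the corresponding primes, determine the trace.\<close>

definition prime_of :: "kind \<times> nat \<Rightarrow> nat" where
  "prime_of l = enumerate {p. prime p} (to_nat l)"

definition weight :: "(kind \<times> nat) multiset \<Rightarrow> nat" where
  "weight L = prod_mset (image_mset prime_of L)"

lemma prime_prime_of: "prime (prime_of l)"
  using enumerate_in_set[OF primes_infinite] by (simp add: prime_of_def)

lemma inj_prime_of: "inj prime_of"
  using strict_mono_enumerate[OF primes_infinite]
  by (auto simp: inj_def prime_of_def strict_mono_eq)

lemma inj_weight: "inj weight"
proof (rule injI)
  fix L M assume "weight L = weight M"
  moreover have "prime_factorization (weight N) = image_mset prime_of N" for N
    unfolding weight_def by (rule prime_factorization_prod_mset_primes) (auto simp: prime_prime_of)
  ultimately have "image_mset prime_of L = image_mset prime_of M"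
    by metis
  then show "L = M"
    using multiset.inj_map[OF inj_prime_of] by (simp add: inj_eq)
qed

text \<open>The entry in row 1 and column 3, though allowed in even elements, is left out: the diagonal
  entries of the values of the even variables suffice to tell traces apart.\<close>

definition probe :: "nat \<Rightarrow> var \<Rightarrow> 'k::field_char_0^3^3" where
  "probe t x = (let p = \<lambda>c i. of_nat (prime_of (c, i)) ^ t in
     case x of
       Y i \<Rightarrow> mat_scale (p Outer i) (mat_unit 1 1 + mat_unit 3 3) + mat_scale (p Inner i) (mat_unit 2 2)
     | Z j \<Rightarrow> mat_scale (p First j) (mat_unit 1 2) + mat_scale (p Second j) (mat_unit 2 3))"

lemma probe_admissible: "probe t (Y i) \<in> alg_A0" "probe t (Z i) \<in> alg_A1"
proof -
  show "probe t (Y i) \<in> alg_A0"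
    unfolding alg_A0_iff
    by (intro exI[where x = 0] exI[where x = "of_nat (prime_of (Outer, i)) ^ t"]
        exI[where x = "of_nat (prime_of (Inner, i)) ^ t"]) (simp add: probe_def)
  show "probe t (Z i) \<in> alg_A1"
    unfolding alg_A1_iff by (auto simp: probe_def)
qed

definition row_sum :: "'k::field_char_0^3^3 \<Rightarrow> 3 \<Rightarrow> 'k" where
  "row_sum M i = (\<Sum>j\<in>UNIV. M $ i $ j)"

lemma row_sum_probe_Y:
  "row_sum (probe t (Y i) ** M) 1 = of_nat (prime_of (Outer, i)) ^ t * row_sum M 1"
  "row_sum (probe t (Y i) ** M) 2 = of_nat (prime_of (Inner, i)) ^ t * row_sum M 2"
  "row_sum (probe t (Y i) ** M) 3 = of_nat (prime_of (Outer, i)) ^ t * row_sum M 3"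
  by (simp_all add: row_sum_def probe_def alg_A_simps distrib_left)

lemma row_sum_probe_Z:
  "row_sum (probe t (Z j) ** M) 1 = of_nat (prime_of (First, j)) ^ t * row_sum M 2"
  "row_sum (probe t (Z j) ** M) 2 = of_nat (prime_of (Second, j)) ^ t * row_sum M 3"
  "row_sum (probe t (Z j) ** M) 3 = 0"
  by (simp_all add: row_sum_def probe_def alg_A_simps distrib_left)

text \<open>The first row is the aim. Rows 2 and 3 belong to the words that remain to be read
  after one or two odd letters, and carry the induction. An odd letter met in row 3 gives zero,
  which is where the words with too many odd letters disappear. A row sum is taken because the
  column of the only nonzero entry depends on the number of odd letters.\<close>

lemma row_sum_probe:
  fixes w :: "var list" and t :: nat
  defines "M \<equiv> (eval_word (probe t) w :: 'k::field_char_0^3^3)"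
  shows "row_sum M 1 = (if num_z w \<le> 2 then of_nat (weight (trace 0 w)) ^ t else 0) \<and>
    row_sum M 2 = (if num_z w \<le> 1 then of_nat (weight (trace 1 w)) ^ t else 0) \<and>
    row_sum M 3 = (if num_z w = 0 then of_nat (weight (trace 2 w)) ^ t else 0)"
  unfolding M_def
proof (induction w)
  case Nil
  show ?case
    by (simp add: eval_word_Nil row_sum_def sum_3 mat_def weight_def)
next
  case (Cons x w)
  then show ?case
    by (cases x)
      (simp_all add: eval_word_Cons row_sum_probe_Y row_sum_probe_Z weight_def
        power_mult_distrib numeral_2_eq_2)
qed

lemma row_sum_linear:
  "row_sum 0 i = 0" "row_sum (M + N) i = row_sum M i + row_sum N i"
  "row_sum (mat_scale c M) i = c * row_sum M i"
  by (simp_all add: row_sum_def sum.distrib mat_scale_def sum_distrib_left)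

text \<open>Collecting words of equal trace in the first row sum of the value under \<open>probe t\<close> gives a
  combination of the \<open>t\<close>-th powers of the weights, which is zero for every \<open>t\<close>.\<close>

lemma trace_sums_vanish:
  fixes f :: "'k::field_char_0 free_alg"
  assumes "f \<in> graded_identities (alg_A0 :: ('k^3^3) set) alg_A1"
  shows "(\<Sum>w | w \<in> Poly_Mapping.keys f \<and> num_z w \<le> 2 \<and> trace 0 w = L. Poly_Mapping.lookup f w) = 0"
proof -
  let ?W = "{w \<in> Poly_Mapping.keys f. num_z w \<le> 2}"
  let ?c = "\<lambda>L. \<Sum>w | w \<in> ?W \<and> trace 0 w = L. Poly_Mapping.lookup f w"
  let ?v = "\<lambda>L. of_nat (weight L) :: 'k"
  have "(\<Sum>L\<in>trace 0 ` ?W. ?c L * ?v L ^ t) = 0" for t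
  proof -
    have "(\<Sum>L\<in>trace 0 ` ?W. ?c L * ?v L ^ t) =
        (\<Sum>L\<in>trace 0 ` ?W. \<Sum>w | w \<in> ?W \<and> trace 0 w = L.
          Poly_Mapping.lookup f w * ?v (trace 0 w) ^ t)"
      by (simp add: sum_distrib_right)
    also have "\<dots> = (\<Sum>w\<in>?W. Poly_Mapping.lookup f w * ?v (trace 0 w) ^ t)"
      by (rule sum.image_gen[symmetric]) simp
    also have "\<dots> = (\<Sum>w\<in>Poly_Mapping.keys f.
        Poly_Mapping.lookup f w * row_sum (eval_word (probe t) w) 1)"
      by (simp add: row_sum_probe[THEN conjunct1] sum.inter_filter if_distrib cong: if_cong)
    also have "\<dots> = row_sum (eval_poly (probe t) f) 1"
      unfolding eval_poly_def
      by (induction rule: infinite_finite_induct) (simp_all add: row_sum_linear)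
    also have "eval_poly (probe t) f = 0"
      using assms by (simp add: graded_identities_def probe_admissible)
    finally show ?thesis
      by (simp add: row_sum_linear)
  qed
  moreover have "inj_on ?v (trace 0 ` ?W)"
    using inj_weight by (auto simp: inj_on_def)
  ultimately have "?c L = 0" if "L \<in> trace 0 ` ?W"
    using that by (intro power_sums_independent[of "trace 0 ` ?W" ?v ?c]) simp_all
  moreover have "?c L = 0" if "L \<notin> trace 0 ` ?W"
    using that by (intro sum.neutral) blast
  ultimately show ?thesis
    by (auto simp: conj_assoc)
qed

context relations
begin

text \<open>Replacing each word by the representative of its trace, and dropping the words with more than
  two odd letters, changes \<open>f\<close> by an element of \<open>I\<close>. The coefficients that meet at one
  representative are those that sum to zero.\<close>

lemma identity_in_I:
  fixes f :: "'k free_alg"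
  assumes "f \<in> graded_identities (alg_A0 :: ('k^3^3) set) alg_A1"
  shows "f \<in> I"
proof -
  let ?W = "{w \<in> Poly_Mapping.keys f. num_z w \<le> 2}"
  let ?r = "\<lambda>w. if num_z w \<le> 2 then monomial (canon (trace 0 w)) (Poly_Mapping.lookup f w) else 0"
  have "monomial w c - (if num_z w \<le> 2 then monomial (canon (trace 0 w)) c else 0) \<in> I" for w c
  proof -
    have "monomial w 1 - (if num_z w \<le> 2 then monomial (canon (trace 0 w)) 1 else 0) \<in> I"
      using cong_canon[of w] many_z_in_I[of w] by (auto simp: cong_I_def)
    then have "scalar c * (monomial w 1 - (if num_z w \<le> 2 then monomial (canon (trace 0 w)) 1 else 0)) \<in> I"
      by (rule I_mult_left)
    then show ?thesis
      by (auto simp: scalar_def right_diff_distrib mult_single plus_list_def split: if_splits)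
  qed
  then have "(\<Sum>w\<in>Poly_Mapping.keys f. monomial w (Poly_Mapping.lookup f w) - ?r w) \<in> I"
    by (intro I_sum)
  then have "f - (\<Sum>w\<in>Poly_Mapping.keys f. ?r w) \<in> I"
    by (simp add: sum_subtractf flip: sum_monomials)
  moreover have "(\<Sum>w\<in>Poly_Mapping.keys f. ?r w) = 0"
  proof -
    have single_sum: "(\<Sum>w\<in>S. monomial v (c w)) = monomial v (\<Sum>w\<in>S. c w)" for S v and c :: "_ \<Rightarrow> 'k"
      by (induction S rule: infinite_finite_induct) (simp_all add: single_add)
    have "(\<Sum>w\<in>Poly_Mapping.keys f. ?r w) =
        (\<Sum>w\<in>?W. monomial (canon (trace 0 w)) (Poly_Mapping.lookup f w))"
      by (simp add: sum.inter_filter)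
    also have "\<dots> = (\<Sum>L\<in>trace 0 ` ?W. \<Sum>w | w \<in> ?W \<and> trace 0 w = L.
        monomial (canon (trace 0 w)) (Poly_Mapping.lookup f w))"
      by (rule sum.image_gen) simp
    also have "\<dots> = (\<Sum>L\<in>trace 0 ` ?W. monomial (canon L)
        (\<Sum>w | w \<in> ?W \<and> trace 0 w = L. Poly_Mapping.lookup f w))"
      by (simp flip: single_sum)
    also have "\<dots> = 0"
      using trace_sums_vanish[OF assms] by (simp add: conj_assoc)
    finally show ?thesis .
  qed
  ultimately show ?thesis
    by simp
qed

end

theorem theorem2:
  "graded_identities (alg_A0 :: ('k::field_char_0^3^3) set) alg_A1 =
     graded_T_ideal_generated {commutator (yv 1) (yv 2), zv 1 * zv 2 * zv 3}"
proof
  show "graded_identities (alg_A0 :: ('k^3^3) set) alg_A1 \<subseteq>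
      graded_T_ideal_generated {commutator (yv 1) (yv 2), zv 1 * zv 2 * zv 3}"
    unfolding graded_T_ideal_generated_def
  proof (intro subsetI InterI)
    fix f :: "'k free_alg" and I :: "'k free_alg set"
    assume f: "f \<in> graded_identities (alg_A0 :: ('k^3^3) set) alg_A1"
    assume "I \<in> {I. graded_T_ideal I \<and> {commutator (yv 1) (yv 2), zv 1 * zv 2 * zv 3} \<subseteq> I}"
    then interpret relations I
      by unfold_locales auto
    show "f \<in> I"
      using f by (rule identity_in_I)
  qed
  show "graded_T_ideal_generated {commutator (yv 1) (yv 2), zv 1 * zv 2 * zv 3} \<subseteq>
      graded_identities (alg_A0 :: ('k^3^3) set) alg_A1"
    unfolding graded_T_ideal_generated_def
    by (rule Inter_lower)
      (simp add: graded_T_ideal_graded_identities[OF alg_A_graded] generators_identities[simplified])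
qed

end
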